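(* Let $\alpha\in(0,1)$ and $r\in\{1,\dots,n-1\}$. Consider the iid model (regression or classification), and score functions $S_y:\mathbb R^d\to\mathbb R$, $y\in\mathcal Y$, computed from an independent training sample (treated as fixed; all probabilities are conditional on it), such that the scores $S_{Y_i}(X_i)$, $1\le i\le n+m$, have no ties almost surely and, when $\mathcal Y=\mathbb R$, for every $x$ the map $y\mapsto S_y(x)$ is right-continuous with left limits. Consider an informative collection $\mathcal I$ which is monotone for the pre-processed $p$-values $\overline{\mathbf p}^0$, in the sense that: (i) if $\mathcal C'\subset\mathcal C$ are subsets of $\{1,\dots,K\}$ (classification) or intervals of $\mathbb R$ (regression) and $\mathcal C\in\mathcal I$, then $\mathcal C'\in\mathcal I$; (ii) almost surely, $t\in(0,1]\mapsto\mathbf 1\{\mathcal C^{t}_{n+i}(\overline{\mathbf p}^0)\in\mathcal I\}$ is right-continuous; (iii) in regression, for all $t\in(0,1)$, almost surely $\mathcal C^{t}_{n+i}(\overline{\mathbf p}^0)$ is an interval. Consider any initial selection rule $\mathcal S^{(0)}\subset\{r+1,\dots,n+m\}$ that is permutation-preserving, i.e., for any permutation $\sigma$ of $\{r+1,\dots,n+m\}$, $$\sigma\Big(\mathcal S^{(0)}\big((X_j,Y_j)_{j\le r},(X_{\sigma(j)})_{r+1\le j\le n+m}\big)\Big)=\mathcal S^{(0)}\big((X_j,Y_j)_{j\le r},(X_j)_{r+1\le j\le n+m}\big).$$ Then the InfoSCOP procedure $\mathcal R^{\mathrm{InfoSCOP}}_\alpha$ satisfies $$\mathbb E\big[\mathrm{FCP}(\mathcal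 R^{\mathrm{InfoSCOP}}_\alpha,Y)\big]\le\alpha .$$ In addition, the associated selection rule $\mathcal S=\mathrm{BH}(\mathbf q^0)$ controls the false discovery rate at level $\alpha$: $$\mathbb E\left[\frac{\sum_{i\in\mathcal S}\mathbf 1\{Y_{n+i}\notin\bigcup_{C\in\mathcal I}C\}}{\max(1,|\mathcal S|)}\right]\le\alpha .$$
   Context: Data: $(X_i,Y_i)\sim P_{XY}$, $1\le i\le n+m$, iid (iid model), with $X_i\in\mathbb R^d$ and $Y_i\in\mathcal Y$, where $\mathcal Y=\mathbb R$ (regression) or $\mathcal Y=\{1,\dots,K\}$ (classification). Indices $1,\dots,n$ form the calibration sample (fully observed), indices $n+1,\dots,n+m$ the test sample (only $X$ observed). Initial selection: $\mathcal S^{(0)}=\mathcal S^{(0)}\big((X_j,Y_j)_{1\le j\le r},(X_j)_{r+1\le j\le n+m}\big)\subset\{r+1,\dots,n+m\}$ is a (measurable) function of the displayed data. Let $\mathcal S^{(0)}_{cal}=\mathcal S^{(0)}\cap\{r+1,\dots,n\}$, $\mathcal T=\{i\in\{1,\dots,m\}: n+i\in\mathcal S^{(0)}\}$ and $m^0=|\mathcal T|$. Pre-processed $p$-values $\overline{\mathbf p}^0$: for $i\in\mathcal T$, $y\in\mathcal Y$, $\overline p^{(0,y)}_i=\frac1{|\mathcal S^{(0)}_{cal}|+1}\big(1+\sum_{j\in\mathcal S^{(0)}_{cal}}\mathbf 1\{S_{Y_j}(X_j)\ge S_y(X_{n+i})\}\big)$, and $\mathcal C^t_{n+i}(\overline{\mathbf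 p}^0)=\{y\in\mathcal Y:\overline p^{(0,y)}_i>t\}$. $\mathcal I$ is a prespecified collection of "informative" subsets of $\mathcal Y$ (intervals if $\mathcal Y=\mathbb R$). $\mathcal I$-adjusted $p$-values: $\mathbf q^0=(q^0_i)_{i\in\mathcal T}$, $q^0_i=\min\{t\in(0,1]:\mathcal C^t_{n+i}(\overline{\mathbf p}^0)\in\mathcal I\}$ ($=1$ if the set is empty). $\mathrm{BH}(\mathbf q^0)=\{i\in\mathcal T: q^0_i\le\alpha\hat\ell/m^0\}$, where $\hat\ell=\max\{\ell\in\{1,\dots,m^0\}: q^0_{(\ell)}\le\alpha\ell/m^0\}$ ($0$ if no such $\ell$) and $q^0_{(1)}\le\dots\le q^0_{(m^0)}$ are the ordered values. InfoSCOP: $\mathcal R^{\mathrm{InfoSCOP}}_\alpha=\big(\mathcal C^{\alpha^0}_{n+i}(\overline{\mathbf p}^0)\big)_{i\in\mathrm{BH}(\mathbf q^0)}$ with $\alpha^0=\alpha|\mathrm{BH}(\mathbf q^0)|/m^0$ (empty procedure if $m^0=0$). For $\mathcal R=(\mathcal C_{n+i})_{i\in\mathcal S}$, $\mathrm{FCP}(\mathcal R,Y)=\frac{\sum_{i\in\mathcal S}\mathbf 1\{Y_{n+i}\notin\mathcal C_{n+i}\}}{\max(1,|\mathcal S|)}$. *)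

theory Defs
  imports "HOL-Probability.Probability"
begin

(* Both tasks use real-valued labels, so that one set of definitions serves
   regression (label space R) and classification (label space {1,...,K}). *)

datatype task = Regression | Classification nat

fun labels :: "task \<Rightarrow> real set" where
  "labels Regression = UNIV"
| "labels (Classification K) = real ` {1..K}"

(* The sets over which informative collections range.  The empty set is an
   interval in the sense of is_interval. *)

fun admissible :: "task \<Rightarrow> real set \<Rightarrow> bool" where
  "admissible Regression C \<longleftrightarrow> is_interval C"
| "admissible (Classification K) C \<longleftrightarrow> C \<subseteq> labels (Classification K)"

definition obs_space :: "task \<Rightarrow> ((real ^ 'd) \<times> real) measure" where
  "obs_space k = borel \<Otimes>\<^sub>M restrict_space borel (labels k)"

(* A sample z maps the index i to (X_i, Y_i).  Indices 1..n form the calibration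
   sample and n+1..n+m the test sample. *)

type_synonym 'd sample = "nat \<Rightarrow> (real ^ 'd) \<times> real"

(* An initial selection rule sees the labelled pairs with index 1..r and the
   covariates with index r+1..n+m.  The arguments are extensional functions on
   these index sets, so the rule has access to nothing else. *)

type_synonym 'd init_rule = "'d sample \<Rightarrow> (nat \<Rightarrow> real ^ 'd) \<Rightarrow> nat set"

definition permutation_preserving ::
  "task \<Rightarrow> nat \<Rightarrow> nat \<Rightarrow> nat \<Rightarrow> ('d :: finite) init_rule \<Rightarrow> bool" where
  "permutation_preserving k r n m S0 \<longleftrightarrow>
     (\<forall>a \<in> space (Pi\<^sub>M {1..r} (\<lambda>_. obs_space k)). \<forall>x \<in> {r+1..n+m} \<rightarrow>\<^sub>E UNIV. \<forall>\<sigma>.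
        \<sigma> permutes {r+1..n+m} \<longrightarrow>
        \<sigma> ` S0 a (\<lambda>j \<in> {r+1..n+m}. x (\<sigma> j)) = S0 a x)"

definition init_sel ::
  "('d :: finite) init_rule \<Rightarrow> nat \<Rightarrow> nat \<Rightarrow> nat \<Rightarrow> 'd sample \<Rightarrow> nat set" where
  "init_sel S0 r n m z = S0 (\<lambda>j \<in> {1..r}. z j) (\<lambda>j \<in> {r+1..n+m}. fst (z j))"

definition sel_cal ::
  "('d :: finite) init_rule \<Rightarrow> nat \<Rightarrow> nat \<Rightarrow> nat \<Rightarrow> 'd sample \<Rightarrow> nat set" where
  "sel_cal S0 r n m z = init_sel S0 r n m z \<inter> {r+1..n}"

definition sel_test ::
  "('d :: finite) init_rule \<Rightarrow> nat \<Rightarrow> nat \<Rightarrow> nat \<Rightarrow> 'd sample \<Rightarrow> nat set" where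
  "sel_test S0 r n m z = {i \<in> {1..m}. n + i \<in> init_sel S0 r n m z}"

definition score :: "(real \<Rightarrow> real ^ 'd \<Rightarrow> real) \<Rightarrow> ('d :: finite) sample \<Rightarrow> nat \<Rightarrow> real" where
  "score S z j = S (snd (z j)) (fst (z j))"

definition pre_pval ::
  "(real \<Rightarrow> real ^ 'd \<Rightarrow> real) \<Rightarrow> ('d :: finite) init_rule \<Rightarrow> nat \<Rightarrow> nat \<Rightarrow> nat
     \<Rightarrow> 'd sample \<Rightarrow> nat \<Rightarrow> real \<Rightarrow> real" where
  "pre_pval S S0 r n m z i y =
     (1 + (\<Sum>j \<in> sel_cal S0 r n m z. of_bool (score S z j \<ge> S y (fst (z (n + i))))))
       / (real (card (sel_cal S0 r n m z)) + 1)"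

definition pre_set ::
  "task \<Rightarrow> (real \<Rightarrow> real ^ 'd \<Rightarrow> real) \<Rightarrow> ('d :: finite) init_rule \<Rightarrow> nat \<Rightarrow> nat \<Rightarrow> nat
     \<Rightarrow> 'd sample \<Rightarrow> nat \<Rightarrow> real \<Rightarrow> real set" where
  "pre_set k S S0 r n m z i t = {y \<in> labels k. pre_pval S S0 r n m z i y > t}"

(* The infimum is the minimum whenever the latter exists.  It is not attained
   exactly when the whole label space is informative (small levels t > 0 yield the
   whole label space); the value is then 0. *)

definition adj_pval ::
  "task \<Rightarrow> real set set \<Rightarrow> (real \<Rightarrow> real ^ 'd \<Rightarrow> real) \<Rightarrow> ('d :: finite) init_rule
     \<Rightarrow> nat \<Rightarrow> nat \<Rightarrow> nat \<Rightarrow> 'd sample \<Rightarrow> nat \<Rightarrow> real" where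
  "adj_pval k \<I> S S0 r n m z i =
     (let A = {t \<in> {0<..1}. pre_set k S S0 r n m z i t \<in> \<I>}
      in if A = {} then 1 else Inf A)"

definition order_stat :: "nat set \<Rightarrow> (nat \<Rightarrow> real) \<Rightarrow> nat \<Rightarrow> real" where
  "order_stat T q l = sort (map q (sorted_list_of_set T)) ! (l - 1)"

definition BH :: "real \<Rightarrow> nat set \<Rightarrow> (nat \<Rightarrow> real) \<Rightarrow> nat set" where
  "BH \<alpha> T q =
     (let m0 = real (card T);
          l = Max (insert 0 {l \<in> {1..card T}. order_stat T q l \<le> \<alpha> * real l / m0})
      in {i \<in> T. q i \<le> \<alpha> * real l / m0})"

definition infoscop_sel ::
  "real \<Rightarrow> task \<Rightarrow> real set set \<Rightarrow> (real \<Rightarrow> real ^ 'd \<Rightarrow> real) \<Rightarrow> ('d :: finite) init_rule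
     \<Rightarrow> nat \<Rightarrow> nat \<Rightarrow> nat \<Rightarrow> 'd sample \<Rightarrow> nat set" where
  "infoscop_sel \<alpha> k \<I> S S0 r n m z =
     BH \<alpha> (sel_test S0 r n m z) (adj_pval k \<I> S S0 r n m z)"

(* A procedure, i.e. a family of label sets indexed by the selected test points,
   is a partial map whose domain is the selection. *)

definition infoscop ::
  "real \<Rightarrow> task \<Rightarrow> real set set \<Rightarrow> (real \<Rightarrow> real ^ 'd \<Rightarrow> real) \<Rightarrow> ('d :: finite) init_rule
     \<Rightarrow> nat \<Rightarrow> nat \<Rightarrow> nat \<Rightarrow> 'd sample \<Rightarrow> (nat \<rightharpoonup> real set)" where
  "infoscop \<alpha> k \<I> S S0 r n m z =
     (let B = infoscop_sel \<alpha> k \<I> S S0 r n m z;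
          \<alpha>0 = \<alpha> * real (card B) / real (card (sel_test S0 r n m z))
      in (\<lambda>i. if i \<in> B then Some (pre_set k S S0 r n m z i \<alpha>0) else None))"

(* In FCP and FDP, y i is the label of the i-th test point.  Their expectations are
   written as nonnegative Lebesgue integrals: an arbitrary informative collection
   need not make them measurable, in which case the Bochner integral is 0 by
   convention, whereas nn_integral is then the lower integral. *)

definition FCP :: "(nat \<rightharpoonup> real set) \<Rightarrow> (nat \<Rightarrow> real) \<Rightarrow> real" where
  "FCP R y = (\<Sum>i \<in> dom R. of_bool (y i \<notin> the (R i))) / max 1 (real (card (dom R)))"

definition FDP :: "real set set \<Rightarrow> nat set \<Rightarrow> (nat \<Rightarrow> real) \<Rightarrow> real" where
  "FDP \<I> B y = (\<Sum>i \<in> B. of_bool (y i \<notin> \<Union>\<I>)) / max 1 (real (card B))"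

end

theory Submission
  imports Defs
begin

text \<open>The data behind the indices \<open>r+1, \<dots>, n+m\<close> are exchangeable, and the initial selection commutes
  with permutations of them. Fix a test point \<open>i\<close> that is initially selected, and call the pool the
  selected calibration points together with \<open>i\<close>. Exchanging \<open>i\<close> with a member of the pool leaves
  the initial selection, hence the pool, unchanged, so the p-value of \<open>i\<close> at its true label is
  the normalised rank of a uniformly drawn member of the pool and is super-uniform.

  The final level \<open>\<alpha>|BH(q)|/m0\<close> is random and depends on the same data. If \<open>i\<close> is finally selected,
  then setting its adjusted p-value to zero does not change the number of rejections
  (\<open>card_BH_update_zero\<close>), so the error made at \<open>i\<close> contributes at most \<open>1/N\<close>, where \<open>N\<close> is the number
  of rejections after this replacement, and only when the true p-value of \<open>i\<close> is at most
  \<open>\<alpha>N/m0\<close>. If a member of the pool with a larger score takes the place of \<open>i\<close>, the remaining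
  calibration scores go down, all prediction sets of the other test points shrink, these become
  informative at smaller levels because the informative collection is closed under
  shrinking, and \<open>N\<close> goes up (\<open>forced_count_mono\<close>). A small p-value thus goes with a
  large \<open>N\<close>, and the average over the pool of \<open>1/N\<close> on the event of an error is at most \<open>\<alpha>/m0\<close>
  (\<open>sum_inverse_below_threshold_le\<close>). Summation over the \<open>m0\<close> test points gives \<open>\<alpha>\<close>.

  An arbitrary informative collection may make the false coverage proportion non-measurable, and
  lower integrals cannot be added up test point by test point. Therefore all the combinatorics takes
  place on a single orbit of the permutation group: the mean of the false coverage proportion over
  the orbit of almost every sample is at most \<open>\<alpha>\<close> (\<open>sum_FCP_permuted_le\<close>), and a bound on orbit
  means bounds the lower integral (\<open>nn_integral_le_by_averaging\<close>).

  The claim on the selection follows, because a finally selected point has an informative prediction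
  set: a label outside every informative set is missed by it (\<open>FDP_le_FCP\<close>).\<close>

section \<open>The Benjamini-Hochberg selection\<close>

lemma nth_sorted_le_iff:
  fixes xs :: "'a :: linorder list"
  assumes "sorted xs" "k < length xs"
  shows "xs ! k \<le> c \<longleftrightarrow> k < length (filter (\<lambda>x. x \<le> c) xs)"
  using assms
proof (induction xs arbitrary: k)
  case (Cons x xs)
  show ?case
  proof (cases "x \<le> c")
    case True
    then show ?thesis using Cons by (cases k) auto
  next
    case False
    then have "filter (\<lambda>x. x \<le> c) xs = []"
      using Cons.prems by (auto simp: filter_empty_conv)
    moreover have "x \<le> (x # xs) ! k"
      using Cons.prems by (cases k) auto
    ultimately show ?thesis using False by auto
  qed
qed simp

lemma order_stat_le_iff:
  assumes "finite T" "1 \<le> l" "l \<le> card T"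
  shows "order_stat T q l \<le> c \<longleftrightarrow> l \<le> card {i \<in> T. q i \<le> c}"
proof -
  let ?xs = "sort (map q (sorted_list_of_set T))"
  have "length (filter (\<lambda>x. x \<le> c) ?xs) = length (filter (\<lambda>x. x \<le> c) (map q (sorted_list_of_set T)))"
    by (metis mset_filter mset_sort size_mset)
  also have "\<dots> = length (filter (\<lambda>i. q i \<le> c) (sorted_list_of_set T))"
    by (simp add: filter_map o_def)
  also have "\<dots> = card {i \<in> T. q i \<le> c}"
    using assms(1) by (subst distinct_length_filter) (auto intro: arg_cong[where f = card])
  finally have "length (filter (\<lambda>x. x \<le> c) ?xs) = card {i \<in> T. q i \<le> c}" .
  moreover have "?xs ! (l - 1) \<le> c \<longleftrightarrow> l - 1 < length (filter (\<lambda>x. x \<le> c) ?xs)"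
    by (rule nth_sorted_le_iff) (use assms in auto)
  ultimately show ?thesis using assms unfolding order_stat_def by auto
qed

text \<open>The threshold rank of the step-up procedure equals the number of rejections, since
  otherwise the number of rejections would itself be a larger candidate for the rank. This
  turns the procedure into a fixed point equation together with a maximality property.\<close>

lemma BH_characterization:
  assumes "finite T" "\<alpha> \<ge> 0"
  shows "BH \<alpha> T q = {i \<in> T. q i \<le> \<alpha> * real (card (BH \<alpha> T q)) / real (card T)} \<and>
    (\<forall>l \<le> card T. l \<le> card {i \<in> T. q i \<le> \<alpha> * real l / real (card T)} \<longrightarrow> l \<le> card (BH \<alpha> T q))"
proof -
  define R where "R l = {i \<in> T. q i \<le> \<alpha> * real l / real (card T)}" for l :: nat
  define L where "L = insert 0 {l \<in> {1..card T}. l \<le> card (R l)}"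
  have L_eq: "L = insert 0 {l \<in> {1..card T}. order_stat T q l \<le> \<alpha> * real l / real (card T)}"
    unfolding L_def R_def using order_stat_le_iff[OF assms(1)] by auto
  have BH_eq: "BH \<alpha> T q = R (Max L)"
    unfolding BH_def Let_def L_eq R_def ..
  have finL: "finite L" unfolding L_def by simp
  have "Max L \<in> L" using finL unfolding L_def by (intro Max_in) auto
  moreover have "\<forall>l\<in>L. l \<le> card (R l)" unfolding L_def by auto
  ultimately have le: "Max L \<le> card (R (Max L))" by blast
  have subR: "R l \<subseteq> T" for l unfolding R_def by auto
  have max: "l \<le> Max L" if "l \<le> card T" "l \<le> card (R l)" for l
    using that finL by (cases "l = 0") (auto simp: L_def intro!: Max_ge)
  have "R (Max L) \<subseteq> R (card (R (Max L)))"
  proof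
    fix i assume i: "i \<in> R (Max L)"
    have "\<alpha> * real (Max L) / real (card T) \<le> \<alpha> * real (card (R (Max L))) / real (card T)"
      using le assms by (intro divide_right_mono mult_left_mono) auto
    then show "i \<in> R (card (R (Max L)))" using i unfolding R_def by auto
  qed
  then have "card (R (Max L)) \<le> card (R (card (R (Max L))))"
    using subR assms(1) by (meson card_mono finite_subset)
  moreover have "card (R (Max L)) \<le> card T"
    using subR assms(1) by (simp add: card_mono)
  ultimately have "card (R (Max L)) = Max L"
    using max le by (simp add: le_antisym)
  then show ?thesis
    using max unfolding BH_eq by (simp add: R_def[symmetric])
qed

lemmas BH_fixed_point = BH_characterization[THEN conjunct1]
lemmas card_BH_greatest = BH_characterization[THEN conjunct2, rule_format]

lemma BH_subset: "BH \<alpha> T q \<subseteq> T"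
  by (auto simp: BH_def Let_def)

lemma card_BH_le: "finite T \<Longrightarrow> card (BH \<alpha> T q) \<le> card T"
  by (simp add: BH_subset card_mono)

lemma card_BH_antimono:
  assumes "finite T" "\<alpha> \<ge> 0" "\<And>i. i \<in> T \<Longrightarrow> q i \<le> q' i"
  shows "card (BH \<alpha> T q') \<le> card (BH \<alpha> T q)"
proof (rule card_BH_greatest[OF assms(1,2)])
  let ?c = "\<alpha> * real (card (BH \<alpha> T q')) / real (card T)"
  have "{i \<in> T. q' i \<le> ?c} \<subseteq> {i \<in> T. q i \<le> ?c}"
    using assms(3) order_trans by blast
  then have "card {i \<in> T. q' i \<le> ?c} \<le> card {i \<in> T. q i \<le> ?c}"
    using assms(1) by (intro card_mono) auto
  then show "card (BH \<alpha> T q') \<le> card {i \<in> T. q i \<le> ?c}"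
    using arg_cong[OF BH_fixed_point[OF assms(1,2), of q'], of card] by (rule ord_eq_le_trans[rotated])
qed (simp add: card_BH_le assms)

lemma card_BH_update_zero_pos:
  assumes "finite T" "\<alpha> \<ge> 0" "i \<in> T"
  shows "1 \<le> card (BH \<alpha> T (q(i := 0)))"
proof (rule card_BH_greatest[OF assms(1,2)])
  show "1 \<le> card T"
    using assms by (auto simp: Suc_le_eq card_gt_0_iff)
  have "i \<in> {j \<in> T. (q(i := 0)) j \<le> \<alpha> * real 1 / real (card T)}"
    using assms by simp
  moreover have "finite {j \<in> T. (q(i := 0)) j \<le> \<alpha> * real 1 / real (card T)}"
    using assms(1) by simp
  ultimately show "1 \<le> card {j \<in> T. (q(i := 0)) j \<le> \<alpha> * real 1 / real (card T)}"
    by (metis One_nat_def Suc_leI card_gt_0_iff empty_iff)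
qed

text \<open>Lowering the value of a hypothesis that is already rejected does not move the step-up
  threshold. The number of rejections can hence be decoupled from the value at a rejected
  index.\<close>

lemma card_BH_update_zero:
  assumes "finite T" "\<alpha> \<ge> 0" "i \<in> BH \<alpha> T q"
  shows "card (BH \<alpha> T (q(i := 0))) = card (BH \<alpha> T q)"
proof (rule antisym)
  define c where "c l = \<alpha> * real l / real (card T)" for l :: nat
  let ?N = "card (BH \<alpha> T q)" and ?N' = "card (BH \<alpha> T (q(i := 0)))"
  have c_mono: "c l \<le> c l'" if "l \<le> l'" for l l'
    unfolding c_def using that assms by (intro divide_right_mono mult_left_mono) auto
  have c_nonneg: "0 \<le> c l" for l unfolding c_def using assms by simp
  have BH: "BH \<alpha> T q = {j \<in> T. q j \<le> c ?N}"
    unfolding c_def by (rule BH_fixed_point[OF assms(1,2)])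
  have BH': "BH \<alpha> T (q(i := 0)) = {j \<in> T. (q(i := 0)) j \<le> c ?N'}"
    unfolding c_def by (rule BH_fixed_point[OF assms(1,2)])
  have i: "i \<in> T" "q i \<le> c ?N" using assms(3) BH by auto
  show le: "?N \<le> ?N'"
  proof (rule card_BH_greatest[OF assms(1,2), folded c_def])
    have "BH \<alpha> T q \<subseteq> {j \<in> T. (q(i := 0)) j \<le> c ?N}"
      using c_nonneg by (subst BH) auto
    then show "?N \<le> card {j \<in> T. (q(i := 0)) j \<le> c ?N}"
      using assms(1) by (simp add: card_mono)
  qed (simp add: card_BH_le assms)
  show "?N' \<le> ?N"
  proof (rule card_BH_greatest[OF assms(1,2), folded c_def])
    have "BH \<alpha> T (q(i := 0)) \<subseteq> {j \<in> T. q j \<le> c ?N'}"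
      using i c_mono[OF le] by (subst BH') (auto split: if_splits)
    then show "?N' \<le> card {j \<in> T. q j \<le> c ?N'}"
      using assms(1) by (simp add: card_mono)
  qed (simp add: card_BH_le assms)
qed

section \<open>Averaging over a finite group of symmetries\<close>

text \<open>The nonnegative integral of a function that need not be measurable is the supremum of the
  integrals of the simple functions below it. A simple minorant composed with a symmetry is a
  simple minorant of the composed function and has the same integral, so that a bound on
  the orbit averages of the function bounds its integral.\<close>

lemma nn_integral_le_by_averaging:
  fixes f :: "'a \<Rightarrow> ennreal" and T :: "'g \<Rightarrow> 'a \<Rightarrow> 'a"
  assumes M: "prob_space M"
    and G: "finite G" "G \<noteq> {}"
    and T: "\<And>g. g \<in> G \<Longrightarrow> T g \<in> measurable M M" "\<And>g. g \<in> G \<Longrightarrow> distr M M (T g) = M"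
    and average: "AE x in M. (\<Sum>g\<in>G. f (T g x)) \<le> of_nat (card G) * c"
  shows "integral\<^sup>N M f \<le> c"
  unfolding nn_integral_def
proof (rule SUP_least, safe)
  interpret prob_space M by (rule M)
  fix s assume s: "simple_function M s" "s \<le> f"
  have meas: "s \<in> borel_measurable M" using s(1) by (rule borel_measurable_simple_function)
  have invariant: "integral\<^sup>N M s = (\<integral>\<^sup>+ x. s (T g x) \<partial>M)" if "g \<in> G" for g
    using nn_integral_distr[OF T(1)[OF that], of s] meas T(2)[OF that] by simp
  have "of_nat (card G) * integral\<^sup>N M s = (\<Sum>g\<in>G. integral\<^sup>N M s)"
    by simp
  also have "\<dots> = (\<Sum>g\<in>G. \<integral>\<^sup>+ x. s (T g x) \<partial>M)"
    by (intro sum.cong refl invariant)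
  also have "\<dots> = (\<integral>\<^sup>+ x. (\<Sum>g\<in>G. s (T g x)) \<partial>M)"
    using meas T(1) by (intro nn_integral_sum[symmetric]) (auto intro: measurable_compose)
  also have "\<dots> \<le> (\<integral>\<^sup>+ x. of_nat (card G) * c \<partial>M)"
  proof (rule nn_integral_mono_AE)
    show "AE x in M. (\<Sum>g\<in>G. s (T g x)) \<le> of_nat (card G) * c"
      using average
    proof eventually_elim
      case (elim x)
      have "(\<Sum>g\<in>G. s (T g x)) \<le> (\<Sum>g\<in>G. f (T g x))"
        using s(2) by (intro sum_mono) (auto simp: le_fun_def)
      with elim show ?case by order
    qed
  qed
  also have "\<dots> = of_nat (card G) * c" by (simp add: emeasure_space_1)
  finally have "integral\<^sup>N M s \<le> c"
    using G by (subst (asm) ennreal_mult_le_mult_iff) auto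
  then show "integral\<^sup>S M s \<le> c"
    using nn_integral_eq_simple_integral[OF s(1)] by simp
qed

lemma distr_PiM_permute:
  assumes "prob_space P" "\<sigma> permutes I"
  shows "distr (Pi\<^sub>M I (\<lambda>_. P)) (Pi\<^sub>M I (\<lambda>_. P)) (\<lambda>z. \<lambda>j\<in>I. z (\<sigma> j)) = Pi\<^sub>M I (\<lambda>_. P)"
  using distr_PiM_reindex[of I "\<lambda>_. P" \<sigma> I] assms permutes_inj_on[OF assms(2)] permutes_in_image[OF assms(2)]
  by auto

text \<open>Double counting of the pairs of a point and a move. The map which sends such a pair to
  the moved point together with the same move is an involution, so every point is
  reached as often as it has moves.\<close>

lemma sum_eq_sum_of_averages:
  fixes h :: "'a \<Rightarrow> real"
  assumes fin: "finite A" "\<And>x. x \<in> A \<Longrightarrow> finite (E x)" "\<And>x. x \<in> A \<Longrightarrow> E x \<noteq> {}"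
    and closed: "\<And>x e. x \<in> A \<Longrightarrow> e \<in> E x \<Longrightarrow> act x e \<in> A"
    and same: "\<And>x e. x \<in> A \<Longrightarrow> e \<in> E x \<Longrightarrow> E (act x e) = E x"
    and invol: "\<And>x e. x \<in> A \<Longrightarrow> e \<in> E x \<Longrightarrow> act (act x e) e = x"
  shows "(\<Sum>x\<in>A. h x) = (\<Sum>x\<in>A. (\<Sum>e\<in>E x. h (act x e)) / real (card (E x)))"
proof -
  have finE: "\<forall>x\<in>A. finite (E x)" using fin(2) by blast
  have "(\<Sum>x\<in>A. h x) = (\<Sum>x\<in>A. \<Sum>e\<in>E x. h x / real (card (E x)))"
  proof (rule sum.cong[OF refl])
    fix x assume "x \<in> A"
    then have "card (E x) \<noteq> 0" using fin(2,3) by (simp add: card_eq_0_iff)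
    then show "h x = (\<Sum>e\<in>E x. h x / real (card (E x)))" by simp
  qed
  also have "\<dots> = (\<Sum>(x, e)\<in>Sigma A E. h x / real (card (E x)))"
    by (rule sum.Sigma[OF fin(1) finE])
  also have "\<dots> = (\<Sum>(x, e)\<in>Sigma A E. h (act x e) / real (card (E x)))"
    by (rule sum.reindex_bij_witness[of _ "\<lambda>(x, e). (act x e, e)" "\<lambda>(x, e). (act x e, e)"])
      (auto simp: closed same invol)
  also have "\<dots> = (\<Sum>x\<in>A. \<Sum>e\<in>E x. h (act x e) / real (card (E x)))"
    by (rule sum.Sigma[OF fin(1) finE, symmetric])
  also have "\<dots> = (\<Sum>x\<in>A. (\<Sum>e\<in>E x. h (act x e)) / real (card (E x)))"
    by (simp add: sum_divide_distrib)
  finally show ?thesis .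
qed

text \<open>The normalised rank of a uniformly drawn score is super-uniform, and this persists for a
  threshold that is proportional to a function of the draw which increases with the score.
  Among the draws whose rank lies below its threshold, the one with the
  smallest score has the largest rank and the largest summand, so it bounds both the number of
  nonzero summands and their size.\<close>

lemma sum_inverse_below_threshold_le:
  fixes s :: "'a \<Rightarrow> real" and N :: "'a \<Rightarrow> nat"
  assumes E: "finite E" and c: "0 \<le> c"
    and pos: "\<And>e. e \<in> E \<Longrightarrow> 1 \<le> N e"
    and mono: "\<And>e f. e \<in> E \<Longrightarrow> f \<in> E \<Longrightarrow> s f \<le> s e \<Longrightarrow> N f \<le> N e"
  shows "(\<Sum>e\<in>E. if real (card {f \<in> E. s e \<le> s f}) / real (card E) \<le> c * real (N e)
            then 1 / real (N e) else 0) \<le> c * real (card E)"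
    (is "(\<Sum>e\<in>E. if ?below e then _ else 0) \<le> _")
proof (cases "{e \<in> E. ?below e} = {}")
  case True
  then have "(\<Sum>e\<in>E. if ?below e then 1 / real (N e) else 0) = 0"
    by (intro sum.neutral) auto
  then show ?thesis using c by simp
next
  case False
  let ?B = "{e \<in> E. ?below e}"
  have finB: "finite ?B" using E by simp
  obtain f where f: "f \<in> ?B" "\<And>e. e \<in> ?B \<Longrightarrow> s f \<le> s e"
    using arg_min_if_finite(1)[OF finB False, of s] arg_min_least[OF finB False, of _ s] by blast
  have card_pos: "0 < real (card E)" using E f by (auto simp: card_gt_0_iff)
  have Nf: "0 < real (N f)" using pos[of f] f by simp
  have "(\<Sum>e\<in>E. if ?below e then 1 / real (N e) else 0) = (\<Sum>e\<in>?B. 1 / real (N e))"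
    using E by (simp add: sum.inter_filter)
  also have "\<dots> \<le> (\<Sum>e\<in>?B. 1 / real (N f))"
    using f Nf mono by (intro sum_mono frac_le) auto
  also have "\<dots> = real (card ?B) / real (N f)" by simp
  also have "\<dots> \<le> real (card {e \<in> E. s f \<le> s e}) / real (N f)"
    using f(2) E by (intro divide_right_mono of_nat_mono card_mono) auto
  also have "\<dots> \<le> c * real (card E)"
    using f(1) card_pos Nf by (simp add: field_simps)
  finally show ?thesis .
qed

section \<open>Exchangeability of the selected sample\<close>

locale infoscop_setting =
  fixes \<alpha> :: real and k :: task and \<I> :: "real set set"
    and S :: "real \<Rightarrow> real ^ 'd :: finite \<Rightarrow> real" and S0 :: "'d init_rule" and r n m :: nat
  assumes r_le: "r \<le> n"
    and alpha: "0 < \<alpha>" "\<alpha> < 1"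
    and informative_subset:
      "\<And>C C'. \<lbrakk>C \<in> \<I>; C' \<subseteq> C; admissible k C; admissible k C'\<rbrakk> \<Longrightarrow> C' \<in> \<I>"
    and S0_subset:
      "\<And>a x. \<lbrakk>a \<in> space (Pi\<^sub>M {1..r} (\<lambda>_. obs_space k)); x \<in> {r+1..n+m} \<rightarrow>\<^sub>E UNIV\<rbrakk>
        \<Longrightarrow> S0 a x \<subseteq> {r+1..n+m}"
    and S0_perm: "permutation_preserving k r n m S0"
begin

abbreviation "sel \<equiv> init_sel S0 r n m"
abbreviation "cal \<equiv> sel_cal S0 r n m"
abbreviation "test \<equiv> sel_test S0 r n m"
abbreviation "pval \<equiv> pre_pval S S0 r n m"
abbreviation "pset \<equiv> pre_set k S S0 r n m"
abbreviation "adj \<equiv> adj_pval k \<I> S S0 r n m"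

definition samples :: "'d sample set" where
  "samples = {1..n+m} \<rightarrow>\<^sub>E UNIV \<times> labels k"

text \<open>The collection is closed under passing to an admissible subset only, so comparisons of
  informativeness require that the prediction sets in question are admissible.\<close>

definition admissible_sets :: "'d sample \<Rightarrow> bool" where
  "admissible_sets z \<longleftrightarrow> (\<forall>i\<in>test z. \<forall>t\<in>{0<..1}. admissible k (pset z i t))"

definition swap :: "'d sample \<Rightarrow> nat \<Rightarrow> nat \<Rightarrow> 'd sample" where
  "swap z i e = z \<circ> Transposition.transpose e (n + i)"

definition true_pval :: "'d sample \<Rightarrow> nat \<Rightarrow> real" where
  "true_pval z i = pval z i (snd (z (n + i)))"

definition pool :: "'d sample \<Rightarrow> nat \<Rightarrow> nat set" where
  "pool z i = insert (n + i) (cal z)"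

text \<open>The number of rejections once a test point is forced into the final selection. Its own adjusted
  p-value, which depends on its covariates in an uncontrolled way, no longer enters.\<close>

definition forced_count :: "'d sample \<Rightarrow> nat \<Rightarrow> nat" where
  "forced_count z i = card (BH \<alpha> (test z) ((adj z)(i := 0)))"

text \<open>A bound for what a test point can contribute to the false coverage proportion. It makes sense
  whether or not the point is finally selected, so it can be averaged over exchanges
  that may affect the final selection.\<close>

definition error_share :: "'d sample \<Rightarrow> nat \<Rightarrow> real" where
  "error_share z i =
    (if true_pval z i \<le> \<alpha> * real (forced_count z i) / real (card (test z))
     then 1 / real (forced_count z i) else 0)"


lemma finite_cal [simp]: "finite (cal z)" by (simp add: sel_cal_def)
lemma finite_test [simp]: "finite (test z)" by (simp add: sel_test_def)
lemma finite_pool [simp]: "finite (pool z i)" by (simp add: pool_def)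

lemma space_obs_space: "space (obs_space k) = UNIV \<times> labels k"
  by (simp add: obs_space_def space_pair_measure space_restrict_space)

lemma labelled_in_space:
  assumes "z \<in> samples"
  shows "(\<lambda>j\<in>{1..r}. z j) \<in> space (Pi\<^sub>M {1..r} (\<lambda>_. obs_space k))"
  using assms r_le by (auto simp: samples_def space_PiM space_obs_space PiE_iff)

lemma sel_subset: "z \<in> samples \<Longrightarrow> sel z \<subseteq> {r+1..n+m}"
  unfolding init_sel_def by (rule S0_subset[OF labelled_in_space]) auto

lemma permuted_sample:
  assumes "z \<in> samples" "\<sigma> permutes {r+1..n+m}"
  shows "z \<circ> \<sigma> \<in> samples"
proof -
  have \<sigma>: "\<sigma> permutes {1..n+m}" using assms(2) by (rule permutes_subset) auto
  show ?thesis
    using assms(1) permutes_in_image[OF \<sigma>] by (auto simp: samples_def PiE_iff extensional_def)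
qed

lemma sel_permute:
  assumes "z \<in> samples" "\<sigma> permutes {r+1..n+m}"
  shows "\<sigma> ` sel (z \<circ> \<sigma>) = sel z"
proof -
  define a where "a = (\<lambda>j\<in>{1..r}. z j)"
  define x where "x = (\<lambda>j\<in>{r+1..n+m}. fst (z j))"
  have "(\<lambda>j\<in>{1..r}. (z \<circ> \<sigma>) j) = a"
    using permutes_not_in[OF assms(2)] by (auto simp: a_def)
  moreover have "(\<lambda>j\<in>{r+1..n+m}. fst ((z \<circ> \<sigma>) j)) = (\<lambda>j\<in>{r+1..n+m}. x (\<sigma> j))"
    using permutes_in_image[OF assms(2)] by (intro restrict_ext) (simp add: x_def)
  ultimately have "sel (z \<circ> \<sigma>) = S0 a (\<lambda>j\<in>{r+1..n+m}. x (\<sigma> j))"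
    by (simp add: init_sel_def)
  moreover have "x \<in> {r+1..n+m} \<rightarrow>\<^sub>E UNIV" by (simp add: x_def)
  moreover have "a \<in> space (Pi\<^sub>M {1..r} (\<lambda>_. obs_space k))"
    unfolding a_def by (rule labelled_in_space[OF assms(1)])
  ultimately have "\<sigma> ` sel (z \<circ> \<sigma>) = S0 a x"
    using S0_perm assms(2) unfolding permutation_preserving_def by metis
  then show ?thesis by (simp add: init_sel_def a_def x_def)
qed

lemma pool_subset_sel: "i \<in> test z \<Longrightarrow> pool z i \<subseteq> sel z"
  by (auto simp: pool_def sel_cal_def sel_test_def)

lemma card_pool: "i \<in> test z \<Longrightarrow> card (pool z i) = card (cal z) + 1"
  by (auto simp: pool_def sel_cal_def sel_test_def)

context
  fixes z i e
  assumes z: "z \<in> samples" and i: "i \<in> test z" and e: "e \<in> pool z i"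
begin

lemma transpose_permutes: "Transposition.transpose e (n + i) permutes {r+1..n+m}"
proof (rule permutes_swap_id)
  have "pool z i \<subseteq> {r+1..n+m}" using pool_subset_sel[OF i] sel_subset[OF z] by blast
  then show "e \<in> {r+1..n+m}" "n + i \<in> {r+1..n+m}" using e by (auto simp: pool_def)
qed

lemma swap_in_samples: "swap z i e \<in> samples"
  unfolding swap_def by (rule permuted_sample[OF z transpose_permutes])

text \<open>Equivariance, applied to the exchange of two selected points: the selection changes
  by the exchange of two of its own members, that is, not at all.\<close>

lemma sel_swap: "sel (swap z i e) = sel z"
proof -
  let ?\<tau> = "Transposition.transpose e (n + i)"
  have "?\<tau> ` sel (swap z i e) = sel z"
    unfolding swap_def by (rule sel_permute[OF z transpose_permutes])
  then have "?\<tau> ` (?\<tau> ` sel (swap z i e)) = ?\<tau> ` sel z" by simp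
  moreover have "?\<tau> ` (?\<tau> ` sel (swap z i e)) = sel (swap z i e)"
    by (simp add: image_image)
  moreover have "?\<tau> ` sel z = sel z"
    using pool_subset_sel[OF i] e by (intro transpose_image_eq) (auto simp: pool_def)
  ultimately show ?thesis by simp
qed

lemma cal_swap: "cal (swap z i e) = cal z"
  by (simp add: sel_cal_def sel_swap)

lemma test_swap: "test (swap z i e) = test z"
  by (simp add: sel_test_def sel_swap)

lemma pool_swap: "pool (swap z i e) i = pool z i"
  by (simp add: pool_def cal_swap)

lemma sum_cal_swap:
  fixes g :: "real \<Rightarrow> real"
  shows "(\<Sum>j\<in>cal z. g (score S (swap z i e) j)) = (\<Sum>j\<in>pool z i - {e}. g (score S z j))"
proof -
  let ?\<tau> = "Transposition.transpose e (n + i)"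
  have ni: "n + i \<notin> cal z" using i by (auto simp: sel_cal_def sel_test_def)
  have "?\<tau> ` cal z = ?\<tau> ` (pool z i - {n + i})"
    using ni by (simp add: pool_def)
  also have "\<dots> = ?\<tau> ` pool z i - {e}"
    by (subst image_set_diff) (auto intro: inj_on_transpose)
  also have "?\<tau> ` pool z i = pool z i"
    using e by (intro transpose_image_eq) (auto simp: pool_def)
  finally have "?\<tau> ` cal z = pool z i - {e}" .
  moreover have "(\<Sum>j\<in>cal z. g (score S (swap z i e) j)) = (\<Sum>j\<in>?\<tau> ` cal z. g (score S z j))"
    by (subst sum.reindex) (auto intro: inj_on_transpose simp: score_def swap_def)
  ultimately show ?thesis by simp
qed

text \<open>The moved point together with the calibration points that remain make up the whole pool, and
  the additional one in the numerator of the p-value counts the comparison of the moved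
  point with itself.\<close>

lemma true_pval_swap:
  "true_pval (swap z i e) i
    = real (card {f \<in> pool z i. score S z e \<le> score S z f}) / real (card (pool z i))"
proof -
  have e_score: "S (snd (swap z i e (n + i))) (fst (swap z i e (n + i))) = score S z e"
    by (simp add: swap_def score_def)
  have "(\<Sum>j\<in>cal z. of_bool (score S z e \<le> score S (swap z i e) j))
      = (\<Sum>j\<in>pool z i - {e}. of_bool (score S z e \<le> score S z j) :: real)"
    by (rule sum_cal_swap)
  then have "1 + (\<Sum>j\<in>cal z. of_bool (score S z e \<le> score S (swap z i e) j))
      = (\<Sum>j\<in>pool z i. of_bool (score S z e \<le> score S z j) :: real)"
    using e by (simp add: sum.remove[OF finite_pool e])
  also have "\<dots> = real (card {f \<in> pool z i. score S z e \<le> score S z f})"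
    by (simp add: Int_def)
  finally show ?thesis
    by (simp add: true_pval_def pre_pval_def e_score cal_swap card_pool[OF i])
qed

text \<open>A point that leaves the calibration sample no longer counts in the comparison with the
  other test points, while the point that it replaces does; the sum over the pool is symmetric in
  both.\<close>

lemma pval_swap:
  assumes "j \<in> test z" "j \<noteq> i"
  shows "pval (swap z i e) j y
    = (1 + (\<Sum>f\<in>pool z i. of_bool (S y (fst (z (n + j))) \<le> score S z f))
         - of_bool (S y (fst (z (n + j))) \<le> score S z e)) / real (card (pool z i))"
proof -
  have "n + j \<noteq> e" "n + j \<noteq> n + i"
    using assms e by (auto simp: pool_def sel_cal_def sel_test_def)
  then have x: "swap z i e (n + j) = z (n + j)"
    by (simp add: swap_def)
  have "(\<Sum>l\<in>cal z. of_bool (S y (fst (z (n + j))) \<le> score S (swap z i e) l))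
      = (\<Sum>l\<in>pool z i - {e}. of_bool (S y (fst (z (n + j))) \<le> score S z l) :: real)"
    by (rule sum_cal_swap)
  then show ?thesis
    by (simp add: pre_pval_def cal_swap x card_pool[OF i] sum.remove[OF finite_pool e])
qed

end

section \<open>Monotonicity of the adjusted p-values\<close>

lemma pval_le_one: "pval z j y \<le> 1"
proof -
  have "(\<Sum>l\<in>cal z. of_bool (S y (fst (z (n + j))) \<le> score S z l) :: real) \<le> (\<Sum>l\<in>cal z. 1)"
    by (intro sum_mono) simp
  then show ?thesis by (simp add: pre_pval_def)
qed

lemma adj_mono:
  assumes le: "\<And>y. y \<in> labels k \<Longrightarrow> pval z j y \<le> pval z' j y"
    and adm: "\<And>t. t \<in> {0<..1} \<Longrightarrow> admissible k (pset z j t)"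
      "\<And>t. t \<in> {0<..1} \<Longrightarrow> admissible k (pset z' j t)"
  shows "adj z j \<le> adj z' j"
proof -
  define A where "A z = {t \<in> {0<..1}. pset z j t \<in> \<I>}" for z
  have adj: "adj z j = (if A z = {} then 1 else Inf (A z))" for z
    unfolding adj_pval_def A_def Let_def ..
  have bdd: "bdd_below (A z)" for z by (rule bdd_belowI[of _ 0]) (auto simp: A_def)
  have sub: "A z' \<subseteq> A z"
  proof
    fix t assume t: "t \<in> A z'"
    have "pset z j t \<subseteq> pset z' j t" using le by (fastforce simp: pre_set_def)
    then show "t \<in> A z" using t adm informative_subset by (auto simp: A_def)
  qed
  show ?thesis
  proof (cases "A z' = {}")
    case True
    have "Inf (A z) \<le> 1" if "A z \<noteq> {}"
      using that bdd by (auto simp: A_def intro: cInf_lower2)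
    then show ?thesis using True by (simp add: adj)
  next
    case False
    then show ?thesis using sub bdd by (auto simp: adj intro!: cInf_superset_mono)
  qed
qed

text \<open>The larger the score that leaves the calibration sample, the smaller are the p-values of the
  other test points, and the smaller are their prediction sets.\<close>

lemma forced_count_mono:
  assumes z: "z \<in> samples" and i: "i \<in> test z" and e: "e \<in> pool z i" and f: "f \<in> pool z i"
    and adm: "\<And>g. g \<in> pool z i \<Longrightarrow> admissible_sets (swap z i g)"
    and le: "score S z f \<le> score S z e"
  shows "forced_count (swap z i f) i \<le> forced_count (swap z i e) i"
  unfolding forced_count_def test_swap[OF z i e] test_swap[OF z i f]
proof (rule card_BH_antimono)
  fix j assume j: "j \<in> test z"
  show "((adj (swap z i e))(i := 0)) j \<le> ((adj (swap z i f))(i := 0)) j"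
  proof (cases "j = i")
    case False
    have "adj (swap z i e) j \<le> adj (swap z i f) j"
    proof (rule adj_mono)
      fix y
      show "pval (swap z i e) j y \<le> pval (swap z i f) j y"
        using le by (simp add: pval_swap[OF z i e j False] pval_swap[OF z i f j False]
            divide_right_mono of_bool_def)
    qed (use adm[OF e] adm[OF f] j in \<open>auto simp: admissible_sets_def test_swap[OF z i e] test_swap[OF z i f]\<close>)
    then show ?thesis using False by simp
  qed simp
qed (use alpha in auto)

section \<open>Bounding the false coverage proportion\<close>

lemma sum_error_share_swap_le:
  assumes z: "z \<in> samples" and i: "i \<in> test z"
    and adm: "\<And>g. g \<in> pool z i \<Longrightarrow> admissible_sets (swap z i g)"
  shows "(\<Sum>e\<in>pool z i. error_share (swap z i e) i) / real (card (pool z i))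
    \<le> \<alpha> / real (card (test z))"
proof -
  have "(\<Sum>e\<in>pool z i. error_share (swap z i e) i)
      = (\<Sum>e\<in>pool z i. if real (card {f \<in> pool z i. score S z e \<le> score S z f}) / real (card (pool z i))
            \<le> \<alpha> / real (card (test z)) * real (forced_count (swap z i e) i)
          then 1 / real (forced_count (swap z i e) i) else 0)"
    by (intro sum.cong) (simp_all add: error_share_def true_pval_swap[OF z i] test_swap[OF z i])
  also have "\<dots> \<le> \<alpha> / real (card (test z)) * real (card (pool z i))"
  proof (rule sum_inverse_below_threshold_le)
    show "1 \<le> forced_count (swap z i e) i" if "e \<in> pool z i" for e
      unfolding forced_count_def test_swap[OF z i that]
      using alpha i by (intro card_BH_update_zero_pos) auto
    show "forced_count (swap z i f) i \<le> forced_count (swap z i e) i"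
      if "e \<in> pool z i" "f \<in> pool z i" "score S z f \<le> score S z e" for e f
      using forced_count_mono[OF z i that(1,2) adm that(3)] .
  qed (use alpha in auto)
  finally show ?thesis
    using card_pool[OF i] by (simp add: field_simps)
qed

lemma FCP_eq:
  "FCP (infoscop \<alpha> k \<I> S S0 r n m z) y
    = (\<Sum>i\<in>infoscop_sel \<alpha> k \<I> S S0 r n m z. of_bool (y i \<notin> pset z i
          (\<alpha> * real (card (infoscop_sel \<alpha> k \<I> S S0 r n m z)) / real (card (test z)))))
      / max 1 (real (card (infoscop_sel \<alpha> k \<I> S S0 r n m z)))"
proof -
  have "dom (infoscop \<alpha> k \<I> S S0 r n m z) = infoscop_sel \<alpha> k \<I> S S0 r n m z"
    by (auto simp: infoscop_def Let_def split: if_splits)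
  then show ?thesis by (simp add: FCP_def infoscop_def Let_def)
qed

text \<open>A selected point whose prediction set misses its label has a true p-value below the final
  level, and that level is not affected by forcing the point into the selection.\<close>

lemma FCP_le_sum_error_share:
  assumes z: "z \<in> samples"
  shows "FCP (infoscop \<alpha> k \<I> S S0 r n m z) (\<lambda>i. snd (z (n + i))) \<le> (\<Sum>i\<in>test z. error_share z i)"
proof -
  define B where "B = infoscop_sel \<alpha> k \<I> S S0 r n m z"
  have B: "B = BH \<alpha> (test z) (adj z)" by (simp add: B_def infoscop_sel_def)
  have sub: "B \<subseteq> test z" unfolding B by (rule BH_subset)
  have "(of_bool (snd (z (n + i)) \<notin> pset z i (\<alpha> * real (card B) / real (card (test z)))) :: real)
      / max 1 (real (card B)) \<le> error_share z i" if i: "i \<in> B" for i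
  proof -
    have "forced_count z i = card B"
      unfolding forced_count_def B using i alpha by (intro card_BH_update_zero) (auto simp: B)
    moreover have "1 \<le> card B"
      using i sub finite_subset[OF sub] by (auto simp: Suc_le_eq card_gt_0_iff)
    moreover have "snd (z (n + i)) \<in> labels k"
    proof -
      have "n + i \<in> {1..n+m}" using i sub by (auto simp: sel_test_def)
      then have "z (n + i) \<in> UNIV \<times> labels k" using z unfolding samples_def by (rule PiE_mem[rotated])
      then show ?thesis by auto
    qed
    ultimately show ?thesis
      by (auto simp: error_share_def true_pval_def pre_set_def)
  qed
  then have "FCP (infoscop \<alpha> k \<I> S S0 r n m z) (\<lambda>i. snd (z (n + i))) \<le> (\<Sum>i\<in>B. error_share z i)"
    unfolding FCP_eq B_def[symmetric] sum_divide_distrib by (rule sum_mono)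
  also have "\<dots> \<le> (\<Sum>i\<in>test z. error_share z i)"
    using sub by (intro sum_mono2) (auto simp: error_share_def)
  finally show ?thesis .
qed

text \<open>Conditionally on the orbit of the sample the permutation is uniformly distributed, so
  exchanging a selected test point with a random member of its pool leaves its mean
  error share over the orbit unchanged. The error share can hence be replaced by its average
  over the pool.\<close>

lemma sum_FCP_permuted_le:
  assumes z: "z \<in> samples"
    and adm: "\<And>\<sigma>. \<sigma> permutes {r+1..n+m} \<Longrightarrow> admissible_sets (z \<circ> \<sigma>)"
  shows "(\<Sum>\<sigma> | \<sigma> permutes {r+1..n+m}.
      FCP (infoscop \<alpha> k \<I> S S0 r n m (z \<circ> \<sigma>)) (\<lambda>i. snd ((z \<circ> \<sigma>) (n + i))))
    \<le> real (card {\<sigma>. \<sigma> permutes {r+1..n+m}}) * \<alpha>"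
proof -
  define G where "G = {\<sigma>. \<sigma> permutes {r+1..n+m}}"
  define A where "A i = {\<sigma> \<in> G. i \<in> test (z \<circ> \<sigma>)}" for i
  define act where "act i \<sigma> e = \<sigma> \<circ> Transposition.transpose e (n + i)" for i e and \<sigma> :: "nat \<Rightarrow> nat"
  have finG: "finite G" unfolding G_def by (simp add: finite_permutations)
  have finA: "finite (A i)" for i using finG by (simp add: A_def)
  have samp: "z \<circ> \<sigma> \<in> samples" if "\<sigma> \<in> G" for \<sigma>
    using that permuted_sample[OF z] by (simp add: G_def)
  have act_swap: "z \<circ> act i \<sigma> e = swap (z \<circ> \<sigma>) i e" for i \<sigma> e
    by (simp add: act_def swap_def comp_assoc)
  have act_G: "act i \<sigma> e \<in> G" if "\<sigma> \<in> A i" "e \<in> pool (z \<circ> \<sigma>) i" for i \<sigma> e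
  proof -
    have "Transposition.transpose e (n + i) permutes {r+1..n+m}"
      using that samp by (intro transpose_permutes[of "z \<circ> \<sigma>"]) (auto simp: A_def)
    then show ?thesis using that by (auto simp: A_def G_def act_def intro: permutes_compose)
  qed
  have orbit: "(\<Sum>\<sigma>\<in>A i. error_share (z \<circ> \<sigma>) i) \<le> (\<Sum>\<sigma>\<in>A i. \<alpha> / real (card (test (z \<circ> \<sigma>))))" for i
  proof -
    have "(\<Sum>\<sigma>\<in>A i. error_share (z \<circ> \<sigma>) i)
        = (\<Sum>\<sigma>\<in>A i. (\<Sum>e\<in>pool (z \<circ> \<sigma>) i. error_share (z \<circ> act i \<sigma> e) i)
            / real (card (pool (z \<circ> \<sigma>) i)))"
    proof (rule sum_eq_sum_of_averages[where h = "\<lambda>\<sigma>. error_share (z \<circ> \<sigma>) i" and E = "\<lambda>\<sigma>. pool (z \<circ> \<sigma>) i"])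
      fix \<sigma> e assume *: "\<sigma> \<in> A i" "e \<in> pool (z \<circ> \<sigma>) i"
      then have zs: "z \<circ> \<sigma> \<in> samples" "i \<in> test (z \<circ> \<sigma>)" using samp by (auto simp: A_def)
      show "act i \<sigma> e \<in> A i"
        using * act_G[OF *] zs by (simp add: A_def act_swap test_swap)
      show "pool (z \<circ> act i \<sigma> e) i = pool (z \<circ> \<sigma>) i"
        using * zs by (simp add: act_swap pool_swap)
      show "act i (act i \<sigma> e) e = \<sigma>"
        by (simp add: act_def comp_assoc)
    qed (use finA in \<open>auto simp: pool_def\<close>)
    also have "\<dots> \<le> (\<Sum>\<sigma>\<in>A i. \<alpha> / real (card (test (z \<circ> \<sigma>))))"
    proof (rule sum_mono)
      fix \<sigma> assume \<sigma>: "\<sigma> \<in> A i"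
      then have zs: "z \<circ> \<sigma> \<in> samples" "i \<in> test (z \<circ> \<sigma>)" using samp by (auto simp: A_def)
      have "admissible_sets (swap (z \<circ> \<sigma>) i e)" if "e \<in> pool (z \<circ> \<sigma>) i" for e
        using adm[of "act i \<sigma> e"] act_G[OF \<sigma> that] by (simp add: act_swap G_def)
      from sum_error_share_swap_le[OF zs this]
      show "(\<Sum>e\<in>pool (z \<circ> \<sigma>) i. error_share (z \<circ> act i \<sigma> e) i) / real (card (pool (z \<circ> \<sigma>) i))
          \<le> \<alpha> / real (card (test (z \<circ> \<sigma>)))"
        by (simp add: act_swap)
    qed
    finally show ?thesis .
  qed
  (* The sum over test points has to be outermost, since the pool depends on the test point. *)
  have flip: "(\<Sum>\<sigma>\<in>G. \<Sum>i\<in>test (z \<circ> \<sigma>). h \<sigma> i) = (\<Sum>i\<in>{1..m}. \<Sum>\<sigma>\<in>A i. h \<sigma> i)"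
    for h :: "(nat \<Rightarrow> nat) \<Rightarrow> nat \<Rightarrow> real"
  proof -
    have "test w = {i \<in> {1..m}. i \<in> test w}" for w by (auto simp: sel_test_def)
    then have "(\<Sum>\<sigma>\<in>G. \<Sum>i\<in>test (z \<circ> \<sigma>). h \<sigma> i)
        = (\<Sum>\<sigma>\<in>G. \<Sum>i\<in>{i \<in> {1..m}. i \<in> test (z \<circ> \<sigma>)}. h \<sigma> i)" by metis
    also have "\<dots> = (\<Sum>i\<in>{1..m}. \<Sum>\<sigma>\<in>A i. h \<sigma> i)"
      unfolding A_def using finG by (intro sum.swap_restrict) auto
    finally show ?thesis .
  qed
  have "(\<Sum>\<sigma>\<in>G. FCP (infoscop \<alpha> k \<I> S S0 r n m (z \<circ> \<sigma>)) (\<lambda>i. snd ((z \<circ> \<sigma>) (n + i))))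
      \<le> (\<Sum>\<sigma>\<in>G. \<Sum>i\<in>test (z \<circ> \<sigma>). error_share (z \<circ> \<sigma>) i)"
    using samp by (intro sum_mono FCP_le_sum_error_share)
  also have "\<dots> = (\<Sum>i\<in>{1..m}. \<Sum>\<sigma>\<in>A i. error_share (z \<circ> \<sigma>) i)" by (rule flip)
  also have "\<dots> \<le> (\<Sum>i\<in>{1..m}. \<Sum>\<sigma>\<in>A i. \<alpha> / real (card (test (z \<circ> \<sigma>))))"
    by (intro sum_mono orbit)
  also have "\<dots> = (\<Sum>\<sigma>\<in>G. \<Sum>i\<in>test (z \<circ> \<sigma>). \<alpha> / real (card (test (z \<circ> \<sigma>))))" by (rule flip[symmetric])
  also have "\<dots> \<le> (\<Sum>\<sigma>\<in>G. \<alpha>)"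
    using alpha by (intro sum_mono) simp
  finally show ?thesis by (simp add: G_def)
qed

section \<open>Prediction sets between two levels\<close>

text \<open>The p-values take finitely many values, so that a prediction set changes only at
  finitely many levels. The level on the right can be chosen rational, which reduces
  statements about all levels to countably many of them.\<close>

lemma pset_right_constant:
  assumes "t < 1"
  obtains u where "u \<in> \<rat>" "t < u" "u < 1" "\<forall>v\<in>{t..u}. pset z i v = pset z i t"
proof -
  define V where "V = insert 1 (pval z i ` labels k)"
  have "pval z i ` labels k \<subseteq> (\<lambda>l. (1 + real l) / (real (card (cal z)) + 1)) ` {..card (cal z)}"
  proof
    fix p assume "p \<in> pval z i ` labels k"
    then obtain y where y: "p = pval z i y" by auto
    let ?J = "cal z \<inter> {j. S y (fst (z (n + i))) \<le> score S z j}"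
    have "p = (1 + real (card ?J)) / (real (card (cal z)) + 1)"
      by (simp add: y pre_pval_def)
    moreover have "card ?J \<le> card (cal z)" by (simp add: card_mono)
    ultimately show "p \<in> (\<lambda>l. (1 + real l) / (real (card (cal z)) + 1)) ` {..card (cal z)}"
      by (intro image_eqI) auto
  qed
  then have "finite (pval z i ` labels k)" by (rule finite_subset) simp
  then have finV: "finite {p \<in> V. t < p}" by (simp add: V_def)
  define w where "w = Min {p \<in> V. t < p}"
  have ne: "{p \<in> V. t < p} \<noteq> {}" using assms by (auto simp: V_def)
  have w: "t < w" "w \<le> 1" "\<And>p. p \<in> V \<Longrightarrow> t < p \<Longrightarrow> w \<le> p"
  proof -
    show "t < w" using Min_in[OF finV ne] by (simp add: w_def)
    show "w \<le> p" if "p \<in> V" "t < p" for p unfolding w_def using that finV by (intro Min_le) auto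
    from this[of 1] show "w \<le> 1" using assms by (simp add: V_def)
  qed
  obtain u where u: "u \<in> \<rat>" "t < u" "u < w" using Rats_dense_in_real[OF w(1)] by auto
  show ?thesis
  proof (rule that[OF u(1,2)])
    show "u < 1" using u w by simp
    show "\<forall>v\<in>{t..u}. pset z i v = pset z i t"
    proof
      fix v assume "v \<in> {t..u}"
      have "v < pval z i y \<longleftrightarrow> t < pval z i y" if y: "y \<in> labels k" for y
      proof -
        have "t < pval z i y \<Longrightarrow> w \<le> pval z i y" using y by (intro w(3)) (simp_all add: V_def)
        then show ?thesis using \<open>v \<in> {t..u}\<close> u(3) by fastforce
      qed
      then show "pset z i v = pset z i t" unfolding pre_set_def by blast
    qed
  qed
qed

lemma admissible_sets_if_rational:
  assumes "k = Regression \<Longrightarrow> \<forall>t\<in>\<rat> \<inter> {0<..<1}. \<forall>i\<in>test z. is_interval (pset z i t)"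
  shows "admissible_sets z"
  unfolding admissible_sets_def
proof (intro ballI)
  fix i t assume i: "i \<in> test z" and t: "t \<in> {0<..1::real}"
  show "admissible k (pset z i t)"
  proof (cases k)
    case Regression
    show ?thesis
    proof (cases "t = 1")
      case True
      have "pset z i t = {}" using True by (simp add: pre_set_def not_less pval_le_one)
      then show ?thesis using Regression by simp
    next
      case False
      then have "t < 1" using t by simp
      then obtain u where u: "u \<in> \<rat>" "t < u" "u < 1" "\<forall>v\<in>{t..u}. pset z i v = pset z i t"
        using pset_right_constant[of t z i] by metis
      have "u \<in> \<rat> \<inter> {0<..<1}" using u(1,2,3) t by simp
      then have "is_interval (pset z i u)" using assms[OF Regression] i by blast
      moreover have "pset z i u = pset z i t" using u(2) by (intro u(4)[rule_format]) simp
      ultimately show ?thesis using Regression by simp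
    qed
  next
    case (Classification K)
    then show ?thesis by (auto simp: pre_set_def)
  qed
qed

text \<open>A selected point has an informative prediction set: its adjusted p-value is at most the final
  level, which is positive, and even if the infimum equals that level, the prediction set is
  informative there because it is locally constant to the right of each level. A label
  outside every informative set is therefore missed by that prediction set.\<close>

lemma FDP_le_FCP:
  assumes adm: "admissible_sets z"
  shows "FDP \<I> (infoscop_sel \<alpha> k \<I> S S0 r n m z) y \<le> FCP (infoscop \<alpha> k \<I> S S0 r n m z) y"
proof -
  define B where "B = infoscop_sel \<alpha> k \<I> S S0 r n m z"
  define a where "a = \<alpha> * real (card B) / real (card (test z))"
  have B: "B = BH \<alpha> (test z) (adj z)" by (simp add: B_def infoscop_sel_def)
  have sub: "B \<subseteq> test z" unfolding B by (rule BH_subset)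
  have "pset z i a \<in> \<I>" if i: "i \<in> B" for i
  proof -
    define A where "A = {t \<in> {0<..1}. pset z i t \<in> \<I>}"
    have it: "i \<in> test z" using i sub by auto
    have finB: "finite B" using sub by (rule finite_subset) simp
    have "card B \<noteq> 0" using i finB by auto
    moreover have "card B \<le> card (test z)" using sub by (intro card_mono) simp_all
    ultimately have cards: "0 < card B" "0 < card (test z)" "card B \<le> card (test z)" by linarith+
    have a_pos: "0 < a" using cards alpha by (simp add: a_def)
    have "\<alpha> * real (card B) \<le> \<alpha> * real (card (test z))"
      using cards(3) alpha(1) by (intro mult_left_mono) simp_all
    then have "a \<le> \<alpha>" using cards(2) by (simp add: a_def divide_le_eq)
    then have a_less: "a < 1" using alpha by simp
    have "adj z i \<le> a"
    proof -
      have "B = {j \<in> test z. adj z j \<le> a}"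
        unfolding a_def B by (rule BH_fixed_point) (use alpha in auto)
      then show ?thesis using i by blast
    qed
    moreover have "adj z i = (if A = {} then 1 else Inf A)"
      unfolding adj_pval_def A_def Let_def ..
    ultimately have ne: "A \<noteq> {}" and le: "Inf A \<le> a"
      using a_less by (auto split: if_splits)
    obtain u where "u \<in> \<rat>" and u: "a < u" "u < 1" "\<forall>v\<in>{a..u}. pset z i v = pset z i a"
      using pset_right_constant[OF a_less, of z i] by metis
    have "Inf A < u" using le u(1) by linarith
    from cInf_lessD[OF ne this] obtain t where t: "t \<in> A" "t < u" by (elim bexE)
    have adm_i: "admissible k (pset z i v)" if "v \<in> {0<..1}" for v
      using adm it that unfolding admissible_sets_def by blast
    show ?thesis
    (* Below the level, informativeness is inherited by the smaller set; above it, and before the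
       next p-value, the set is the same. *)
    proof (cases "t \<le> a")
      case True
      then have "pset z i a \<subseteq> pset z i t" by (auto simp: pre_set_def)
      moreover have "pset z i t \<in> \<I>" "t \<in> {0<..1}" "a \<in> {0<..1}"
        using t(1) a_pos a_less by (simp_all add: A_def)
      ultimately show ?thesis using adm_i informative_subset by metis
    next
      case False
      then have "pset z i t = pset z i a" using t(2) by (intro u(3)[rule_format]) simp
      then show ?thesis using t(1) by (simp add: A_def)
    qed
  qed
  then have "(of_bool (y i \<notin> \<Union>\<I>) :: real) \<le> of_bool (y i \<notin> pset z i a)" if "i \<in> B" for i
    using that by (auto simp: of_bool_def)
  then show ?thesis
    unfolding FDP_def FCP_eq B_def[symmetric] a_def[symmetric]
    by (intro divide_right_mono sum_mono) simp_all
qed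

end

section \<open>Error control\<close>

theorem theorem3p3:
  fixes \<alpha> :: real
    and r n m :: nat
    and k :: task
    and P :: "((real ^ 'd :: finite) \<times> real) measure"
    and S :: "real \<Rightarrow> real ^ 'd \<Rightarrow> real"
    and \<I> :: "real set set"
    and S0 :: "'d init_rule"
  assumes alpha: "0 < \<alpha>" "\<alpha> < 1"
    and r: "1 \<le> r" "r \<le> n - 1"
    and P: "prob_space P" "sets P = sets (obs_space k)"
    and score_measurable: "\<forall>y \<in> labels k. S y \<in> borel_measurable borel"
    and no_ties: "AE z in Pi\<^sub>M {1..n+m} (\<lambda>_. P). inj_on (score S z) {1..n+m}"
    and cadlag: "k = Regression \<Longrightarrow>
        \<forall>x y. continuous (at_right y) (\<lambda>u. S u x) \<and> (\<exists>l. ((\<lambda>u. S u x) \<longlongrightarrow> l) (at_left y))"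
    and informative: "\<forall>C \<in> \<I>. admissible k C"
    and mono_i: "\<forall>C C'. admissible k C \<and> admissible k C' \<and> C' \<subseteq> C \<and> C \<in> \<I> \<longrightarrow> C' \<in> \<I>"
    and mono_ii: "AE z in Pi\<^sub>M {1..n+m} (\<lambda>_. P). \<forall>i \<in> sel_test S0 r n m z. \<forall>t \<in> {0<..1}.
        continuous (at t within {t..1}) (\<lambda>u. of_bool (pre_set k S S0 r n m z i u \<in> \<I>) :: real)"
    and mono_iii: "k = Regression \<Longrightarrow> \<forall>t \<in> {0<..<1}. AE z in Pi\<^sub>M {1..n+m} (\<lambda>_. P).
        \<forall>i \<in> sel_test S0 r n m z. is_interval (pre_set k S S0 r n m z i t)"
    and S0_measurable: "(\<lambda>(a, x). S0 a x) \<in>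
        Pi\<^sub>M {1..r} (\<lambda>_. obs_space k) \<Otimes>\<^sub>M Pi\<^sub>M {r+1..n+m} (\<lambda>_. borel)
          \<rightarrow>\<^sub>M count_space (Pow {r+1..n+m})"
    and S0_perm: "permutation_preserving k r n m S0"
  shows "(\<integral>\<^sup>+ z. ennreal (FCP (infoscop \<alpha> k \<I> S S0 r n m z) (\<lambda>i. snd (z (n + i))))
            \<partial>(Pi\<^sub>M {1..n+m} (\<lambda>_. P))) \<le> ennreal \<alpha>
       \<and> (\<integral>\<^sup>+ z. ennreal (FDP \<I> (infoscop_sel \<alpha> k \<I> S S0 r n m z) (\<lambda>i. snd (z (n + i))))
            \<partial>(Pi\<^sub>M {1..n+m} (\<lambda>_. P))) \<le> ennreal \<alpha>"
proof -
  define M where "M = Pi\<^sub>M {1..n+m} (\<lambda>_. P)"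
  define G where "G = {\<sigma>. \<sigma> permutes {r+1..n+m}}"
  define T :: "(nat \<Rightarrow> nat) \<Rightarrow> 'd sample \<Rightarrow> 'd sample"
    where "T \<sigma> z = (\<lambda>j\<in>{1..n+m}. z (\<sigma> j))" for \<sigma> z
  interpret infoscop_setting \<alpha> k \<I> S S0 r n m
  proof
    fix a :: "'d sample" and x :: "nat \<Rightarrow> real ^ 'd"
    assume "a \<in> space (Pi\<^sub>M {1..r} (\<lambda>_. obs_space k))" "x \<in> {r+1..n+m} \<rightarrow>\<^sub>E UNIV"
    then have "(a, x) \<in> space (Pi\<^sub>M {1..r} (\<lambda>_. obs_space k) \<Otimes>\<^sub>M Pi\<^sub>M {r+1..n+m} (\<lambda>_. borel))"
      by (simp add: space_pair_measure space_PiM)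
    from measurable_space[OF S0_measurable this] show "S0 a x \<subseteq> {r+1..n+m}" by simp
  qed (use alpha r S0_perm mono_i in auto)
  interpret M: prob_space M unfolding M_def by (intro prob_space_PiM P(1))
  have space_M: "space M = samples"
    using sets_eq_imp_space_eq[OF P(2)] by (simp add: M_def space_PiM samples_def space_obs_space)
  have perm: "\<sigma> permutes {1..n+m}" if "\<sigma> \<in> G" for \<sigma>
    using that unfolding G_def by (auto intro: permutes_subset)
  have T_eq: "T \<sigma> z = z \<circ> \<sigma>" if "\<sigma> \<in> G" "z \<in> samples" for \<sigma> z
    using permutes_not_in[OF perm[OF that(1)]] that(2)
    by (force simp: T_def samples_def PiE_iff extensional_def)
  have T_meas: "T \<sigma> \<in> measurable M M" if "\<sigma> \<in> G" for \<sigma>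
    unfolding T_def M_def using permutes_in_image[OF perm[OF that]]
    by (intro measurable_restrict measurable_component_singleton) auto
  have T_distr: "distr M M (T \<sigma>) = M" if "\<sigma> \<in> G" for \<sigma>
    unfolding T_def M_def using perm[OF that] P(1) by (intro distr_PiM_permute)
  have finG: "finite G" by (simp add: G_def finite_permutations)
  have "id \<in> G" by (simp add: G_def)
  then have neG: "G \<noteq> {}" by blast
  (* The null set on which intervals fail may depend on the level, hence the rational levels. *)
  have adm: "AE z in M. admissible_sets z"
  proof (cases "k = Regression")
    case True
    have rationals: "countable (\<rat> \<inter> {0<..<1} :: real set)" by (simp add: countable_rat)
    have "AE z in M. \<forall>t\<in>\<rat> \<inter> {0<..<1}. \<forall>i\<in>test z. is_interval (pset z i t)"
    proof (subst AE_ball_countable[OF rationals], intro ballI)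
      fix t :: real assume "t \<in> \<rat> \<inter> {0<..<1}"
      then have "t \<in> {0<..<1}" by simp
      then show "AE z in M. \<forall>i\<in>test z. is_interval (pset z i t)"
        unfolding M_def by (rule bspec[OF mono_iii[OF True]])
    qed
    then show ?thesis
      by (rule AE_mp) (auto intro: admissible_sets_if_rational)
  next
    case False
    then show ?thesis using admissible_sets_if_rational by simp
  qed
  have "AE z in M. admissible_sets (T \<sigma> z)" if "\<sigma> \<in> G" for \<sigma>
    by (rule AE_distrD[OF T_meas[OF that]]) (simp only: T_distr[OF that] adm)
  then have adm_G: "AE z in M. \<forall>\<sigma>\<in>G. admissible_sets (T \<sigma> z)"
    using finG by (subst AE_ball_countable) (auto intro: countable_finite)
  let ?FCP = "\<lambda>z. FCP (infoscop \<alpha> k \<I> S S0 r n m z) (\<lambda>i. snd (z (n + i)))"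
  let ?FDP = "\<lambda>z. FDP \<I> (infoscop_sel \<alpha> k \<I> S S0 r n m z) (\<lambda>i. snd (z (n + i)))"
  have FCP_nonneg: "0 \<le> ?FCP z" for z by (auto simp: FCP_def intro!: divide_nonneg_nonneg sum_nonneg)
  have FCR: "(\<integral>\<^sup>+ z. ennreal (?FCP z) \<partial>M) \<le> ennreal \<alpha>"
  proof (rule nn_integral_le_by_averaging[OF M.prob_space_axioms finG neG T_meas T_distr])
    show "AE z in M. (\<Sum>\<sigma>\<in>G. ennreal (?FCP (T \<sigma> z))) \<le> of_nat (card G) * ennreal \<alpha>"
      using adm_G AE_space
    proof eventually_elim
      case (elim z)
      then have z: "z \<in> samples" by (simp add: space_M)
      have "(\<Sum>\<sigma>\<in>G. ennreal (?FCP (T \<sigma> z))) = ennreal (\<Sum>\<sigma>\<in>G. ?FCP (z \<circ> \<sigma>))"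
      proof -
        have "(\<Sum>\<sigma>\<in>G. ennreal (?FCP (T \<sigma> z))) = (\<Sum>\<sigma>\<in>G. ennreal (?FCP (z \<circ> \<sigma>)))"
          using z by (intro sum.cong) (simp_all add: T_eq)
        then show ?thesis using sum_ennreal[of G "\<lambda>\<sigma>. ?FCP (z \<circ> \<sigma>)"] FCP_nonneg by metis
      qed
      also have "\<dots> \<le> ennreal (real (card G) * \<alpha>)"
        unfolding G_def
      proof (intro ennreal_leI sum_FCP_permuted_le[OF z])
        fix \<sigma> assume "\<sigma> permutes {r+1..n+m}"
        then have "\<sigma> \<in> G" by (simp add: G_def)
        then show "admissible_sets (z \<circ> \<sigma>)" using elim(1) z T_eq by metis
      qed
      also have "\<dots> = of_nat (card G) * ennreal \<alpha>"
        using alpha by (simp add: ennreal_mult ennreal_of_nat_eq_real_of_nat)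
      finally show ?case .
    qed
  qed
  moreover have "(\<integral>\<^sup>+ z. ennreal (?FDP z) \<partial>M) \<le> (\<integral>\<^sup>+ z. ennreal (?FCP z) \<partial>M)"
    using adm by (intro nn_integral_mono_AE) (auto elim!: eventually_mono intro: ennreal_leI FDP_le_FCP)
  ultimately show ?thesis unfolding M_def by (auto intro: order_trans)
qed

end
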